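(* Let $(S,+,\circ)$ be a weak brace, and put $\lambda_a(b)=a\circ(a^-+b)$ and $\rho_b(a)=(a^-+b)^-\circ b$ for $a,b\in S$. Then $$a\circ b=\lambda_a(b)\circ\rho_b(a)$$ holds for all $a,b\in S$.
   Context: A semigroup is inverse if each element $a$ has a unique inverse, i.e. a unique $x$ with $axa=a$ and $xax=x$. A weak (left) brace is a non-empty set $S$ with two binary operations $+$ and $\circ$ such that $(S,+)$ and $(S,\circ)$ are both inverse semigroups (not necessarily commutative) and, for all $a,b,c\in S$, $a\circ(b+c)=a\circ b-a+a\circ c$ and $a\circ a^-=-a+a$, where $-a$ is the inverse of $a$ in $(S,+)$, $a^-$ is the inverse of $a$ in $(S,\circ)$, and $\circ$ has higher precedence than $+$. *)

theory Defs
  imports Main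
begin

text \<open>Semigroups live on an explicit carrier set \<open>S\<close>; the operations are unconstrained outside it.\<close>

locale inverse_semigroup_on =
  fixes S :: "'a set" and f :: "'a \<Rightarrow> 'a \<Rightarrow> 'a" (infixl "\<bullet>" 70)
  assumes closed: "\<lbrakk>a \<in> S; b \<in> S\<rbrakk> \<Longrightarrow> a \<bullet> b \<in> S"
    and assoc: "\<lbrakk>a \<in> S; b \<in> S; c \<in> S\<rbrakk> \<Longrightarrow> (a \<bullet> b) \<bullet> c = a \<bullet> (b \<bullet> c)"
    and ex1_inverse: "a \<in> S \<Longrightarrow> \<exists>!x. x \<in> S \<and> a \<bullet> x \<bullet> a = a \<and> x \<bullet> a \<bullet> x = x"
begin

definition inverse_of :: "'a \<Rightarrow> 'a" where
  "inverse_of a = (THE x. x \<in> S \<and> a \<bullet> x \<bullet> a = a \<and> x \<bullet> a \<bullet> x = x)"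

lemma inverse_of:
  assumes "a \<in> S"
  shows "inverse_of a \<in> S" "a \<bullet> inverse_of a \<bullet> a = a"
    "inverse_of a \<bullet> a \<bullet> inverse_of a = inverse_of a"
  using theI'[OF ex1_inverse[OF assms]] unfolding inverse_of_def by blast+

end

locale weak_brace =
  add: inverse_semigroup_on S add + circ: inverse_semigroup_on S circ
  for S :: "'a set"
    and add :: "'a \<Rightarrow> 'a \<Rightarrow> 'a" (infixl "\<oplus>" 65)
    and circ :: "'a \<Rightarrow> 'a \<Rightarrow> 'a" (infixl "\<odot>" 70) +
  assumes nonempty: "S \<noteq> {}"
    and circ_add: "\<lbrakk>a \<in> S; b \<in> S; c \<in> S\<rbrakk> \<Longrightarrow>
      a \<odot> (b \<oplus> c) = a \<odot> b \<oplus> add.inverse_of a \<oplus> a \<odot> c"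
    and circ_inverse: "a \<in> S \<Longrightarrow> a \<odot> circ.inverse_of a = add.inverse_of a \<oplus> a"
begin

definition lam :: "'a \<Rightarrow> 'a \<Rightarrow> 'a" where
  "lam a b = a \<odot> (circ.inverse_of a \<oplus> b)"

text \<open>The subscript comes first: \<open>rho b a\<close> is $\rho_b(a)$.\<close>

definition rho :: "'a \<Rightarrow> 'a \<Rightarrow> 'a" where
  "rho b a = circ.inverse_of (circ.inverse_of a \<oplus> b) \<odot> b"

end

end

theory Submission
  imports Defs
begin

text \<open>
  Put \<open>e = a\<^sup>- \<odot> a\<close> and \<open>c = a\<^sup>- \<oplus> b\<close>, so that the claim reads \<open>a \<odot> b = a \<odot> (c \<odot> c\<^sup>-) \<odot> b\<close>. Since
  \<open>a = a \<odot> e\<close> and \<open>b = (b \<odot> b\<^sup>-) \<odot> b\<close>, it suffices that \<open>e \<odot> (c \<odot> c\<^sup>-) = e \<odot> (b \<odot> b\<^sup>-)\<close>.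

  By the second brace axiom \<open>c \<odot> c\<^sup>- = -c \<oplus> c = -b \<oplus> e \<oplus> b\<close>. The key fact is that the additive
  semigroup is Clifford, that is \<open>-x \<oplus> x = x \<oplus> -x\<close> for all \<open>x\<close>
  (\<open>add_inverse_commute\<close>); applied to \<open>e \<oplus> b\<close> it turns the conjugate \<open>-b \<oplus> e \<oplus> b\<close> into
  \<open>e \<oplus> (b \<odot> b\<^sup>-)\<close>. The first axiom, for the idempotent \<open>e\<close>, then gives
  \<open>e \<odot> (e \<oplus> x) = e \<oplus> e \<odot> x\<close>, and left multiples \<open>e \<odot> x\<close> absorb \<open>e\<close> additively
  (\<open>idem_add_circ\<close>), so the \<open>e\<close> inside the bracket disappears.

  The absorption law also yields the Clifford property: with \<open>e = -x \<oplus> x = x \<odot> x\<^sup>-\<close> one has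
  \<open>e \<odot> x = x\<close>, hence \<open>-x \<oplus> x \<oplus> x = x\<close>, and the same for \<open>-x\<close>.
\<close>

section \<open>Inverse semigroups\<close>

context inverse_semigroup_on
begin

lemma inverse_of_unique:
  assumes "a \<in> S" "x \<in> S" "a \<bullet> x \<bullet> a = a" "x \<bullet> a \<bullet> x = x"
  shows "inverse_of a = x"
  using ex1_inverse[OF assms(1)] inverse_of[OF assms(1)] assms by blast

lemma inverse_of_inverse_of: "a \<in> S \<Longrightarrow> inverse_of (inverse_of a) = a"
  by (simp add: inverse_of inverse_of_unique)

lemma inverse_of_idem: "e \<in> S \<Longrightarrow> e \<bullet> e = e \<Longrightarrow> inverse_of e = e"
  by (simp add: inverse_of_unique)

lemma inverse_mult_idem:
  "a \<in> S \<Longrightarrow> (inverse_of a \<bullet> a) \<bullet> (inverse_of a \<bullet> a) = inverse_of a \<bullet> a"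
  by (metis assoc closed inverse_of)

lemma mult_inverse_idem:
  "a \<in> S \<Longrightarrow> (a \<bullet> inverse_of a) \<bullet> (a \<bullet> inverse_of a) = a \<bullet> inverse_of a"
  by (metis assoc closed inverse_of)

text \<open>
  If \<open>x\<close> is the inverse of \<open>e \<bullet> g\<close>, then so is \<open>g \<bullet> x \<bullet> e\<close>, which is idempotent. By uniqueness
  \<open>x\<close> is an idempotent, and an idempotent is its own inverse, so \<open>e \<bullet> g = x\<close>.
\<close>

lemma idem_mult_idem:
  assumes "e \<in> S" "g \<in> S" "e \<bullet> e = e" "g \<bullet> g = g"
  shows "(e \<bullet> g) \<bullet> (e \<bullet> g) = e \<bullet> g"
proof -
  define x where "x = inverse_of (e \<bullet> g)"
  have eg: "e \<bullet> g \<in> S" using assms closed by simp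
  have x: "x \<in> S" "e \<bullet> g \<bullet> x \<bullet> (e \<bullet> g) = e \<bullet> g" "x \<bullet> (e \<bullet> g) \<bullet> x = x"
    unfolding x_def using inverse_of[OF eg] by auto
  have ee: "e \<bullet> (e \<bullet> y) = e \<bullet> y" and gg: "g \<bullet> (g \<bullet> y) = g \<bullet> y" if "y \<in> S" for y
    using assms that by (metis assoc)+
  have x2: "e \<bullet> (g \<bullet> (x \<bullet> (e \<bullet> g))) = e \<bullet> g" using x assms by (simp add: assoc closed)
  have x3: "x \<bullet> (e \<bullet> (g \<bullet> x)) = x" using x assms by (simp add: assoc closed)
  have x3': "x \<bullet> (e \<bullet> (g \<bullet> (x \<bullet> y))) = x \<bullet> y" if "y \<in> S" for y
    using arg_cong[OF x3, of "\<lambda>z. z \<bullet> y"] that x assms by (simp add: assoc closed)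
  have x_eq: "x = g \<bullet> x \<bullet> e"
    by (subst x_def, rule inverse_of_unique)
      (use assms x(1) x2 x3' in \<open>simp_all add: assoc closed ee gg\<close>)
  have "(g \<bullet> x \<bullet> e) \<bullet> (g \<bullet> x \<bullet> e) = g \<bullet> x \<bullet> e"
    using assms x(1) x3' by (simp add: assoc closed)
  then have "x \<bullet> x = x" using x_eq by simp
  then have "inverse_of x = x" using x inverse_of_idem by simp
  moreover have "inverse_of x = e \<bullet> g" unfolding x_def using inverse_of_inverse_of[OF eg] .
  ultimately show ?thesis using \<open>x \<bullet> x = x\<close> by simp
qed

text \<open>Both \<open>g \<bullet> e\<close> and \<open>e \<bullet> g\<close> itself are inverses of \<open>e \<bullet> g\<close>.\<close>

lemma idem_commute:
  assumes "e \<in> S" "g \<in> S" "e \<bullet> e = e" "g \<bullet> g = g"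
  shows "e \<bullet> g = g \<bullet> e"
proof -
  have ee: "e \<bullet> (e \<bullet> y) = e \<bullet> y" and gg: "g \<bullet> (g \<bullet> y) = g \<bullet> y" if "y \<in> S" for y
    using assms that by (metis assoc)+
  have eg: "(e \<bullet> g) \<bullet> (e \<bullet> g) = e \<bullet> g" and ge: "(g \<bullet> e) \<bullet> (g \<bullet> e) = g \<bullet> e"
    using idem_mult_idem assms by auto
  have "inverse_of (e \<bullet> g) = g \<bullet> e"
    by (rule inverse_of_unique)
      (use assms eg ge in \<open>simp_all add: assoc closed ee gg\<close>)
  then show ?thesis using inverse_of_idem[OF _ eg] assms closed by simp
qed

lemma inverse_of_mult:
  assumes "a \<in> S" "b \<in> S"
  shows "inverse_of (a \<bullet> b) = inverse_of b \<bullet> inverse_of a"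
proof -
  let ?a = "inverse_of a" and ?b = "inverse_of b"
  have S: "?a \<in> S" "?b \<in> S" using assms inverse_of by auto
  have com: "(b \<bullet> ?b) \<bullet> (?a \<bullet> a) = (?a \<bullet> a) \<bullet> (b \<bullet> ?b)"
    by (rule idem_commute) (use assms S mult_inverse_idem inverse_mult_idem closed in auto)
  have "a \<bullet> b \<bullet> (?b \<bullet> ?a) \<bullet> (a \<bullet> b) = a \<bullet> ((b \<bullet> ?b) \<bullet> (?a \<bullet> a)) \<bullet> b"
    using assms S by (simp add: assoc closed)
  also have "\<dots> = (a \<bullet> ?a \<bullet> a) \<bullet> (b \<bullet> ?b \<bullet> b)"
    unfolding com using assms S by (simp add: assoc closed)
  also have "\<dots> = a \<bullet> b" using assms inverse_of by simp
  finally have 1: "a \<bullet> b \<bullet> (?b \<bullet> ?a) \<bullet> (a \<bullet> b) = a \<bullet> b" .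
  have "?b \<bullet> ?a \<bullet> (a \<bullet> b) \<bullet> (?b \<bullet> ?a) = ?b \<bullet> ((?a \<bullet> a) \<bullet> (b \<bullet> ?b)) \<bullet> ?a"
    using assms S by (simp add: assoc closed)
  also have "\<dots> = (?b \<bullet> b \<bullet> ?b) \<bullet> (?a \<bullet> a \<bullet> ?a)"
    unfolding com[symmetric] using assms S by (simp add: assoc closed)
  also have "\<dots> = ?b \<bullet> ?a" using assms inverse_of by simp
  finally have 2: "?b \<bullet> ?a \<bullet> (a \<bullet> b) \<bullet> (?b \<bullet> ?a) = ?b \<bullet> ?a" .
  show ?thesis using inverse_of_unique[OF _ _ 1 2] assms S closed by simp
qed

end

section \<open>Idempotents of a weak brace\<close>

context weak_brace
begin

text \<open>
  A multiplicative idempotent \<open>e\<close> is its own inverse, so \<open>e = e \<odot> e\<^sup>- = -e \<oplus> e\<close>.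
\<close>

lemma circ_idem_imp_add_idem:
  assumes "e \<in> S" "e \<odot> e = e"
  shows "e \<oplus> e = e"
  using circ_inverse[OF assms(1)] circ.inverse_of_idem[OF assms]
    add.inverse_mult_idem[OF assms(1)] assms by simp

text \<open>
  Put \<open>h = e \<odot> (x \<odot> x\<^sup>-)\<close>. Expanding \<open>e \<odot> (f \<oplus> f)\<close> for \<open>f = x \<odot> x\<^sup>-\<close> shows that \<open>h\<close> lies
  below \<open>e\<close> in the additive order of idempotents; and \<open>h\<close> is the right unit \<open>-y \<oplus> y\<close> of
  \<open>y = e \<odot> x\<close>.
\<close>

lemma circ_add_idem:
  assumes e: "e \<in> S" "e \<odot> e = e" and x: "x \<in> S"
  shows "e \<odot> x \<oplus> e = e \<odot> x"
proof -
  define f where "f = x \<odot> circ.inverse_of x"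
  define h where "h = e \<odot> f"
  define y where "y = e \<odot> x"
  have f: "f \<in> S" "f \<odot> f = f"
    unfolding f_def using x circ.closed circ.inverse_of circ.mult_inverse_idem by auto
  have y: "y \<in> S" and h: "h \<in> S" "h \<odot> h = h"
    unfolding h_def y_def using e x f circ.closed circ.idem_mult_idem by auto
  note idem = circ_idem_imp_add_idem
  have ne: "add.inverse_of e = e" using add.inverse_of_idem e idem by simp
  have com: "h \<oplus> e = e \<oplus> h" using add.idem_commute e h idem by simp
  have "h = e \<odot> (f \<oplus> f)" unfolding h_def using idem[OF f] by simp
  also have "\<dots> = h \<oplus> e \<oplus> h" using circ_add[OF e(1) f(1) f(1)] ne h_def by simp
  also have "\<dots> = h \<oplus> e"
    using com idem[OF h] e h by (metis add.assoc)
  finally have he: "h \<oplus> e = h" by simp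
  have "circ.inverse_of y = circ.inverse_of x \<odot> e"
    unfolding y_def using circ.inverse_of_mult circ.inverse_of_idem e x by simp
  then have "y \<odot> circ.inverse_of y = (e \<odot> f) \<odot> e"
    unfolding y_def f_def using e x circ.inverse_of by (simp add: circ.assoc circ.closed)
  also have "\<dots> = h"
    unfolding h_def using circ.idem_commute[OF e(1) f(1) e(2) f(2)] e f
    by (metis circ.assoc)
  finally have hy: "h = add.inverse_of y \<oplus> y" using circ_inverse y by simp
  have ny: "add.inverse_of y \<in> S" using add.inverse_of y by simp
  have yh: "y \<oplus> h = y"
    unfolding hy using add.inverse_of(2)[OF y] y ny by (simp add: add.assoc)
  have "y \<oplus> e = y \<oplus> h \<oplus> e" using yh by simp
  also have "\<dots> = y" using add.assoc[OF y h(1) e(1)] he yh by simp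
  finally show ?thesis unfolding y_def .
qed

text \<open>
  Multiplication by an idempotent commutes with negation: expanding \<open>e \<odot> (x \<oplus> (-x \<oplus> x))\<close>
  leaves terms \<open>-e = e\<close> between the summands, which the preceding absorption law removes.
\<close>

lemma idem_circ_neg:
  assumes e: "e \<in> S" "e \<odot> e = e" and x: "x \<in> S"
  shows "add.inverse_of (e \<odot> x) = e \<odot> add.inverse_of x"
proof -
  have ne: "add.inverse_of e = e"
    using add.inverse_of_idem e circ_idem_imp_add_idem by simp
  have sandwich: "e \<odot> u \<oplus> e \<odot> v \<oplus> e \<odot> u = e \<odot> u"
    if u: "u \<in> S" and v: "v \<in> S" and uv: "u \<oplus> v \<oplus> u = u" for u v
  proof -
    have "e \<odot> (u \<oplus> v \<oplus> u) = e \<odot> u \<oplus> e \<oplus> e \<odot> v \<oplus> e \<oplus> e \<odot> u"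
      using circ_add e u v ne add.closed by simp
    also have "\<dots> = e \<odot> u \<oplus> e \<odot> v \<oplus> e \<odot> u"
      using circ_add_idem[OF e u] circ_add_idem[OF e v]
        add.assoc[of "e \<odot> u" "e \<odot> v" e] e u v circ.closed
      by simp
    finally show ?thesis using uv by simp
  qed
  show ?thesis
    by (rule add.inverse_of_unique)
      (use e x sandwich add.inverse_of circ.closed in auto)
qed

text \<open>The mirror image of \<open>circ_add_idem\<close>, obtained from it by negating both sides.\<close>

lemma idem_add_circ:
  assumes e: "e \<in> S" "e \<odot> e = e" and x: "x \<in> S"
  shows "e \<oplus> e \<odot> x = e \<odot> x"
proof -
  let ?x = "add.inverse_of x"
  have nx: "?x \<in> S" "add.inverse_of ?x = x"
    using add.inverse_of add.inverse_of_inverse_of x by auto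
  have ne: "add.inverse_of e = e"
    using add.inverse_of_idem e circ_idem_imp_add_idem by simp
  have "e \<oplus> e \<odot> x = add.inverse_of (e \<odot> ?x \<oplus> e)"
    using add.inverse_of_mult idem_circ_neg[OF e nx(1)] nx ne e circ.closed by simp
  also have "\<dots> = e \<odot> x"
    using circ_add_idem[OF e nx(1)] idem_circ_neg[OF e nx(1)] nx by simp
  finally show ?thesis .
qed

lemma idem_circ_idem_add:
  assumes e: "e \<in> S" "e \<odot> e = e" and x: "x \<in> S"
  shows "e \<odot> (e \<oplus> x) = e \<odot> x"
proof -
  have "e \<odot> (e \<oplus> x) = e \<oplus> e \<oplus> e \<odot> x"
    using circ_add[OF e(1) e(1) x] add.inverse_of_idem e circ_idem_imp_add_idem by simp
  then show ?thesis using circ_idem_imp_add_idem[OF e] idem_add_circ[OF e x] by simp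
qed

section \<open>The additive semigroup is Clifford\<close>

lemma neg_add_self_add:
  assumes x: "x \<in> S"
  shows "add.inverse_of x \<oplus> x \<oplus> x = x"
proof -
  let ?e = "x \<odot> circ.inverse_of x"
  have "?e \<oplus> ?e \<odot> x = ?e \<odot> x"
    by (rule idem_add_circ) (use x circ.closed circ.inverse_of circ.mult_inverse_idem in auto)
  then show ?thesis using circ.inverse_of(2)[OF x] circ_inverse[OF x] by simp
qed

text \<open>
  By \<open>neg_add_self_add\<close> the idempotent \<open>x \<oplus> -x\<close> lies below \<open>-x \<oplus> x\<close>; replacing \<open>x\<close> by \<open>-x\<close>
  reverses the inequality.
\<close>

lemma add_inverse_commute:
  assumes x: "x \<in> S"
  shows "add.inverse_of x \<oplus> x = x \<oplus> add.inverse_of x"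
proof -
  let ?n = "add.inverse_of x"
  have n: "?n \<in> S" "add.inverse_of ?n = x"
    using add.inverse_of add.inverse_of_inverse_of x by auto
  have below: "?n \<oplus> x \<oplus> (x \<oplus> ?n) = x \<oplus> ?n"
    using neg_add_self_add[OF x] add.assoc[of "?n \<oplus> x" x ?n] x n add.closed by simp
  have above: "x \<oplus> ?n \<oplus> (?n \<oplus> x) = ?n \<oplus> x"
    using neg_add_self_add[OF n(1)] add.assoc[of "x \<oplus> ?n" ?n x] x n add.closed by simp
  have "?n \<oplus> x \<oplus> (x \<oplus> ?n) = x \<oplus> ?n \<oplus> (?n \<oplus> x)"
    by (rule add.idem_commute)
      (use x n add.closed add.inverse_mult_idem add.mult_inverse_idem in auto)
  then show ?thesis using below above by simp
qed

section \<open>The factorisation\<close>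

text \<open>
  Conjugation by \<open>b\<close> acts on the idempotent \<open>e = a\<^sup>- \<odot> a = -a\<^sup>- \<oplus> a\<^sup>-\<close> as addition of
  \<open>b \<odot> b\<^sup>-\<close>, because the two units \<open>-t \<oplus> t\<close> and \<open>t \<oplus> -t\<close> of \<open>t = e \<oplus> b\<close> agree.
\<close>

lemma circ_inverse_of_sum:
  assumes a: "a \<in> S" and b: "b \<in> S"
  defines "c \<equiv> circ.inverse_of a \<oplus> b"
  shows "c \<odot> circ.inverse_of c = circ.inverse_of a \<odot> a \<oplus> b \<odot> circ.inverse_of b"
proof -
  define w where "w = circ.inverse_of a"
  define e where "e = w \<odot> a"
  define t where "t = e \<oplus> b"
  let ?b = "add.inverse_of b" and ?w = "add.inverse_of w"
  have w: "w \<in> S" "circ.inverse_of w = a"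
    unfolding w_def using circ.inverse_of circ.inverse_of_inverse_of a by auto
  have e: "e \<in> S" "e \<odot> e = e"
    unfolding e_def w_def using a circ.inverse_of circ.closed circ.inverse_mult_idem by auto
  have e_eq: "e = ?w \<oplus> w" unfolding e_def using circ_inverse[OF w(1)] w(2) by simp
  have ee: "e \<oplus> e = e" using circ_idem_imp_add_idem[OF e] .
  have S: "?b \<in> S" "?w \<in> S" using add.inverse_of b w by auto
  have t: "t \<in> S" unfolding t_def using e b add.closed by simp
  have nt: "add.inverse_of t = ?b \<oplus> e"
    unfolding t_def using add.inverse_of_mult add.inverse_of_idem e ee b by simp
  have c: "c \<in> S" "c = w \<oplus> b" unfolding c_def w_def[symmetric] using w b add.closed by auto
  have "c \<odot> circ.inverse_of c = (?b \<oplus> ?w) \<oplus> (w \<oplus> b)"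
    using circ_inverse[OF c(1)] c(2) add.inverse_of_mult w b by simp
  also have "\<dots> = ?b \<oplus> e \<oplus> b"
    unfolding e_eq using b w S by (simp add: add.assoc add.closed)
  also have "\<dots> = ?b \<oplus> (e \<oplus> e) \<oplus> b" unfolding ee ..
  also have "\<dots> = add.inverse_of t \<oplus> t"
    unfolding nt unfolding t_def using b e S by (simp add: add.assoc add.closed)
  also have "\<dots> = t \<oplus> add.inverse_of t" using add_inverse_commute[OF t] .
  also have "\<dots> = e \<oplus> ((b \<oplus> ?b) \<oplus> e)"
    unfolding nt unfolding t_def using b e S by (simp add: add.assoc add.closed)
  also have "\<dots> = e \<oplus> (e \<oplus> (b \<oplus> ?b))"
    using add.idem_commute[of "b \<oplus> ?b" e] add.mult_inverse_idem[OF b] b S e ee add.closed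
    by simp
  also have "\<dots> = e \<oplus> (b \<oplus> ?b)" using add.assoc[of e e "b \<oplus> ?b"] ee e b S add.closed by simp
  also have "\<dots> = e \<oplus> b \<odot> circ.inverse_of b"
    using add_inverse_commute[OF b] circ_inverse[OF b] by simp
  finally show ?thesis unfolding e_def w_def .
qed

end

theorem lemma13:
  fixes S :: "'a set"
    and add :: "'a \<Rightarrow> 'a \<Rightarrow> 'a" (infixl "\<oplus>" 65)
    and circ :: "'a \<Rightarrow> 'a \<Rightarrow> 'a" (infixl "\<odot>" 70)
  assumes "weak_brace S (\<oplus>) (\<odot>)"
    and "a \<in> S" and "b \<in> S"
  shows "a \<odot> b = weak_brace.lam S (\<oplus>) (\<odot>) a b \<odot> weak_brace.rho S (\<oplus>) (\<odot>) b a"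
proof -
  interpret weak_brace S "(\<oplus>)" "(\<odot>)" by fact
  note a = assms(2) and b = assms(3)
  define w where "w = circ.inverse_of a"
  define e where "e = w \<odot> a"
  define f where "f = b \<odot> circ.inverse_of b"
  define c where "c = w \<oplus> b"
  have w: "w \<in> S" unfolding w_def using circ.inverse_of a by simp
  have e: "e \<in> S" "e \<odot> e = e"
    unfolding e_def w_def using a circ.inverse_of circ.closed circ.inverse_mult_idem by auto
  have f: "f \<in> S" unfolding f_def using circ.closed circ.inverse_of b by simp
  have c: "c \<in> S" "circ.inverse_of c \<in> S"
    unfolding c_def using add.closed circ.inverse_of w b by auto
  have cc: "c \<odot> circ.inverse_of c = e \<oplus> f"
    unfolding c_def e_def f_def w_def using circ_inverse_of_sum[OF a b] .
  have ae: "a \<odot> e = a"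
    unfolding e_def w_def using circ.inverse_of[OF a] a by (simp add: circ.assoc)
  have fb: "f \<odot> b = b" unfolding f_def using circ.inverse_of(2)[OF b] .
  have "lam a b \<odot> rho b a = (a \<odot> c) \<odot> (circ.inverse_of c \<odot> b)"
    unfolding lam_def rho_def c_def w_def ..
  also have "\<dots> = a \<odot> (c \<odot> circ.inverse_of c) \<odot> b"
    using a b c by (simp add: circ.assoc circ.closed)
  also have "\<dots> = (a \<odot> e) \<odot> (e \<oplus> f) \<odot> b" unfolding cc ae ..
  also have "\<dots> = a \<odot> (e \<odot> (e \<oplus> f)) \<odot> b"
    using a e f by (simp add: circ.assoc add.closed)
  also have "\<dots> = a \<odot> (e \<odot> f) \<odot> b" unfolding idem_circ_idem_add[OF e f] ..
  also have "\<dots> = (a \<odot> e) \<odot> (f \<odot> b)"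
    using a b e f by (simp add: circ.assoc circ.closed)
  also have "\<dots> = a \<odot> b" unfolding ae fb ..
  finally show ?thesis by simp
qed

end
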